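(* Let $k=\mathbb{C}$, let $f\in k[X_1,\dots,X_n]$ be a non-constant squarefree polynomial of degree $d$, and let $F\in k[x_0,x_1,\dots,x_n]$ be its homogenization, where $X_i=x_i/x_0$ for $i=1,\dots,n$; that is, $F=x_0^d f(x_1/x_0,\dots,x_n/x_0)$. Then the following holds: \begin{enumerate} \item if $d$ is even, then $\sqrt{f}$ is rationalizable if and only if $\sqrt{F}$ is rationalizable; \item if $d$ is odd, then $\sqrt{f}$ is rationalizable if and only if $\sqrt{x_0F}$ is rationalizable. \end{enumerate}
   Context: For a polynomial ring $R$ over $k=\mathbb{C}$ in finitely many variables, with field of fractions $Q$, and $g\in R$, the square root $\sqrt{g}$ is called rationalizable if there is a (unital) homomorphism of $k$-algebras $\phi\colon Q\to Q$ such that $\phi(g)$ is a square in $Q$. Rationalizability of $\sqrt{f}$ is with respect to $Q=k(X_1,\dots,X_n)$; rationalizability of $\sqrt{F}$ and $\sqrt{x_0F}$ is with respect to $Q'=k(x_0,x_1,\dots,x_n)$. *)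

theory Defs
  imports
    Complex_Main
    "HOL-Library.Poly_Mapping"
    "HOL-Library.Option_ord"
    "HOL-Computational_Algebra.Fraction_Field"
    "HOL-Computational_Algebra.Squarefree"
begin

text \<open>
  Polynomials over the complex numbers with variables indexed by \<open>'v\<close>, as finitely supported maps
  from exponent vectors to coefficients; multiplication is the convolution product of
  \<^theory>\<open>HOL-Library.Poly_Mapping\<close>. A polynomial ring in finitely many variables is obtained
  for \<open>'v\<close> of class \<^class>\<open>finite\<close>. The linear order on \<open>'v\<close> is only needed because the library
  proves that this ring is an integral domain for linearly ordered index types.
\<close>

type_synonym 'v mpoly = "('v \<Rightarrow>\<^sub>0 nat) \<Rightarrow>\<^sub>0 complex"

type_synonym 'v ratfun = "'v mpoly fract"

definition mconst :: "complex \<Rightarrow> 'v mpoly" where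
  "mconst c = Poly_Mapping.single 0 c"

definition mvar :: "'v \<Rightarrow> 'v mpoly" where
  "mvar i = Poly_Mapping.single (Poly_Mapping.single i 1) 1"

definition ratfun_of :: "'v::linorder mpoly \<Rightarrow> 'v ratfun" where
  "ratfun_of p = Fract p 1"

definition ratconst :: "complex \<Rightarrow> 'v::linorder ratfun" where
  "ratconst c = ratfun_of (mconst c)"

definition monom_deg :: "('v \<Rightarrow>\<^sub>0 nat) \<Rightarrow> nat" where
  "monom_deg m = (\<Sum>i\<in>Poly_Mapping.keys m. Poly_Mapping.lookup m i)"

text \<open>By convention the zero polynomial has total degree \<open>0\<close>.\<close>

definition total_degree :: "'v mpoly \<Rightarrow> nat" where
  "total_degree p = Max (insert 0 (monom_deg ` Poly_Mapping.keys p))"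

definition ratfun_eval :: "('v \<Rightarrow> 'w::linorder ratfun) \<Rightarrow> 'v mpoly \<Rightarrow> 'w ratfun" where
  "ratfun_eval x p =
    (\<Sum>m\<in>Poly_Mapping.keys p. ratconst (Poly_Mapping.lookup p m) *
       (\<Prod>i\<in>Poly_Mapping.keys m. x i ^ Poly_Mapping.lookup m i))"

text \<open>
  Homogenization of a polynomial in the variables \<open>'n\<close> is a polynomial in the variables
  \<open>'n option\<close>: the index \<open>None\<close> is the new homogenizing variable \<open>x\<^sub>0\<close>, and \<open>Some i\<close> is
  the variable \<open>x\<^sub>i\<close> with \<open>X\<^sub>i = x\<^sub>i / x\<^sub>0\<close>. Each monomial \<open>m\<close> is multiplied by
  \<open>x\<^sub>0\<close> to the power \<open>d - monom_deg m\<close>, a truncating subtraction that never truncates here.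
  Lemma \<open>ratfun_of_homogenize\<close> below is the identity \<open>F = x\<^sub>0\<^sup>d f(x\<^sub>1/x\<^sub>0, \<dots>, x\<^sub>n/x\<^sub>0)\<close>,
  which determines the homogenization by \<open>ratfun_of_inject\<close>.
\<close>

definition homogenize_exp :: "nat \<Rightarrow> ('n \<Rightarrow>\<^sub>0 nat) \<Rightarrow> ('n option \<Rightarrow>\<^sub>0 nat)" where
  "homogenize_exp d m = Poly_Mapping.single None (d - monom_deg m) +
    (\<Sum>i\<in>Poly_Mapping.keys m. Poly_Mapping.single (Some i) (Poly_Mapping.lookup m i))"

definition homogenize :: "'n mpoly \<Rightarrow> 'n option mpoly" where
  "homogenize f = (\<Sum>m\<in>Poly_Mapping.keys f.
     Poly_Mapping.single (homogenize_exp (total_degree f) m) (Poly_Mapping.lookup f m))"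

definition algebra_hom :: "('v::linorder ratfun \<Rightarrow> 'w::linorder ratfun) \<Rightarrow> bool" where
  "algebra_hom \<phi> \<longleftrightarrow>
     \<phi> 1 = 1 \<and>
     (\<forall>p q. \<phi> (p + q) = \<phi> p + \<phi> q) \<and>
     (\<forall>p q. \<phi> (p * q) = \<phi> p * \<phi> q) \<and>
     (\<forall>c q. \<phi> (ratconst c * q) = ratconst c * \<phi> q)"

text \<open>Rationalizability of the square root of \<open>g\<close>, with respect to the full fraction field of the
  polynomial ring in which \<open>g\<close> lives.\<close>

definition sqrt_rationalizable :: "'v::{finite,linorder} mpoly \<Rightarrow> bool" where
  "sqrt_rationalizable g \<longleftrightarrow>
     (\<exists>\<phi> :: 'v ratfun \<Rightarrow> 'v ratfun. algebra_hom \<phi> \<and> (\<exists>h. \<phi> (ratfun_of g) = h ^ 2))"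

lemma ratfun_of_inject: "ratfun_of p = ratfun_of q \<longleftrightarrow> p = q"
  by (simp add: ratfun_of_def eq_fract)

lemma ratfun_of_0: "ratfun_of 0 = 0"
  by (simp add: ratfun_of_def Zero_fract_def)

lemma ratfun_of_1: "ratfun_of 1 = 1"
  by (simp add: ratfun_of_def One_fract_def)

lemma ratfun_of_add: "ratfun_of (p + q) = ratfun_of p + ratfun_of q"
  by (simp add: ratfun_of_def)

lemma ratfun_of_mult: "ratfun_of (p * q) = ratfun_of p * ratfun_of q"
  by (simp add: ratfun_of_def)

lemma ratfun_of_power: "ratfun_of (p ^ k) = ratfun_of p ^ k"
  by (induction k) (simp_all add: ratfun_of_1 ratfun_of_mult)

lemma ratfun_of_sum: "ratfun_of (sum g A) = (\<Sum>a\<in>A. ratfun_of (g a))"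
  by (induction A rule: infinite_finite_induct) (simp_all add: ratfun_of_0 ratfun_of_add)

lemma ratfun_of_prod: "ratfun_of (prod g A) = (\<Prod>a\<in>A. ratfun_of (g a))"
  by (induction A rule: infinite_finite_induct) (simp_all add: ratfun_of_1 ratfun_of_mult)

lemma mvar_power: "mvar i ^ k = Poly_Mapping.single (Poly_Mapping.single i k) 1"
proof (induction k)
  case (Suc k)
  then show ?case
    by (simp add: mvar_def mult_single single_add [symmetric])
qed simp

lemma single_sum_exp:
  "Poly_Mapping.single (\<Sum>i\<in>A. e i) (1::complex) = (\<Prod>i\<in>A. Poly_Mapping.single (e i) 1)"
proof (induction A rule: infinite_finite_induct)
  case (insert x A)
  have "Poly_Mapping.single (e x + (\<Sum>i\<in>A. e i)) (1::complex) =
    Poly_Mapping.single (e x) 1 * Poly_Mapping.single (\<Sum>i\<in>A. e i) 1"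
    by (simp add: mult_single)
  with insert show ?case by simp
qed simp_all

lemma single_homogenize_exp:
  "Poly_Mapping.single (homogenize_exp d m) c =
    mconst c * mvar None ^ (d - monom_deg m) *
      (\<Prod>i\<in>Poly_Mapping.keys m. mvar (Some i) ^ Poly_Mapping.lookup m i)"
  by (simp add: mvar_power mconst_def homogenize_exp_def single_sum_exp [symmetric] mult_single)

lemma mvar_nonzero: "mvar i \<noteq> 0"
  unfolding mvar_def by (metis lookup_single_eq lookup_zero zero_neq_one)

lemma monom_deg_le_total_degree:
  assumes "m \<in> Poly_Mapping.keys p"
  shows "monom_deg m \<le> total_degree p"
  unfolding total_degree_def using assms by (intro Max_ge) auto

lemma ratfun_of_homogenize:
  fixes f :: "'n::linorder mpoly"
  shows "ratfun_of (homogenize f) = ratfun_of (mvar None) ^ total_degree f *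
    ratfun_eval (\<lambda>i. ratfun_of (mvar (Some i)) / ratfun_of (mvar None)) f"
proof -
  define x0 :: "'n option ratfun" where "x0 = ratfun_of (mvar None)"
  define x :: "'n \<Rightarrow> 'n option ratfun" where "x = (\<lambda>i. ratfun_of (mvar (Some i)))"
  have x0: "x0 \<noteq> 0"
    using ratfun_of_inject [of "mvar None" "0 :: 'n option mpoly"]
    by (simp add: x0_def ratfun_of_0 mvar_nonzero)
  have *: "ratfun_of (Poly_Mapping.single (homogenize_exp (total_degree f) m) (Poly_Mapping.lookup f m))
    = x0 ^ total_degree f * (ratconst (Poly_Mapping.lookup f m) *
       (\<Prod>i\<in>Poly_Mapping.keys m. (x i / x0) ^ Poly_Mapping.lookup m i))"
    if m: "m \<in> Poly_Mapping.keys f" for m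
  proof -
    have "(\<Prod>i\<in>Poly_Mapping.keys m. (x i / x0) ^ Poly_Mapping.lookup m i) =
      (\<Prod>i\<in>Poly_Mapping.keys m. x i ^ Poly_Mapping.lookup m i) / x0 ^ monom_deg m"
      by (simp add: power_divide prod_dividef monom_deg_def power_sum)
    moreover have "x0 ^ total_degree f = x0 ^ (total_degree f - monom_deg m) * x0 ^ monom_deg m"
      using monom_deg_le_total_degree [OF m] by (simp add: power_add [symmetric])
    ultimately show ?thesis
      using x0 by (simp add: single_homogenize_exp ratfun_of_mult ratfun_of_power ratfun_of_prod
          ratconst_def x0_def [symmetric] x_def [symmetric] fun_cong [OF x_def, symmetric])
  qed
  show ?thesis
    unfolding homogenize_def ratfun_eval_def ratfun_of_sum sum_distrib_left
    using * by (simp add: x0_def x_def)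
qed

end

theory Submission
  imports
    Defs
    "HOL-Computational_Algebra.Polynomial"
    "HOL-Analysis.Continuum_Not_Denumerable"
begin

text \<open>
  Write \<open>Q = k(X\<^sub>1, \<dots>, X\<^sub>n)\<close> and \<open>Q' = k(x\<^sub>0, \<dots>, x\<^sub>n)\<close>. Multiplying each \<open>x\<^sub>i\<close> with
  \<open>i \<ge> 1\<close> by \<open>x\<^sub>0\<close> is an automorphism of \<open>Q'\<close>, and it carries \<open>F\<close> to
  \<open>x\<^sub>0\<^sup>d f(x\<^sub>1, \<dots>, x\<^sub>n)\<close>. Whichever of \<open>F\<close> and \<open>x\<^sub>0 F\<close> has even degree therefore differs from
  \<open>f(x\<^sub>1, \<dots>, x\<^sub>n)\<close> by an automorphism and a square, and homomorphisms preserve squares. So the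
  claim reduces to this: \<open>\<surd>f\<close> is rationalizable over \<open>Q\<close> if and only if it is rationalizable over
  \<open>Q' = Q(x\<^sub>0)\<close>, in which \<open>x\<^sub>0\<close> is a dummy variable (\<open>sqrt_rationalizable_homogenize_iff\<close>).

  A homomorphism \<open>\<phi>: Q \<rightarrow> Q\<close> extends to \<open>Q'\<close> by fixing \<open>x\<^sub>0\<close>; this is well defined because \<open>x\<^sub>0\<close> is
  transcendental over \<open>Q\<close> (\<open>sqrt_rationalizable_add_var\<close>).

  Conversely, a homomorphism \<open>\<Phi>: Q' \<rightarrow> Q'\<close> that makes \<open>f\<close> a square restricts to some
  \<open>\<psi>: Q \<rightarrow> Q'\<close>, and the surplus variable has to be eliminated from its values. The element
  \<open>\<Phi>(x\<^sub>0)\<close> is transcendental over \<open>\<psi>(Q)\<close>, so not all of \<open>x\<^sub>0, \<dots>, x\<^sub>n\<close> are algebraic over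
  \<open>\<psi>(Q)\<close> (\<open>algebraic_of_algebraic_variables\<close>); permuting the variables, let \<open>x\<^sub>0\<close> be
  transcendental. Then the elements \<open>a\<^sub>i = \<psi>(X\<^sub>i)\<close> are algebraically independent over \<open>k(x\<^sub>0)\<close>. Substituting
  a constant \<open>x\<^sub>0 = c\<close> keeps any finite set of monomials in the \<open>a\<^sub>i\<close> linearly independent over \<open>k\<close>
  for all but finitely many \<open>c\<close> (\<open>finite_dependent_specializations\<close>). There are only countably many
  finite sets of monomials, whereas \<open>\<complex>\<close> is uncountable. Hence some \<open>c\<close> keeps the \<open>a\<^sub>i\<close>
  algebraically independent, and \<open>X\<^sub>i \<mapsto> a\<^sub>i(c)\<close> defines a homomorphism \<open>Q \<rightarrow> Q\<close> that sends \<open>f\<close> to a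
  square (\<open>sqrt_rationalizable_of_transcendental_variable\<close>).

  Nearly all identities between homomorphisms are proved by comparing them on constants and
  variables (\<open>mpoly_morph_eqI\<close>), and injectivity by exhibiting a left inverse.
\<close>

section \<open>Ring homomorphisms\<close>

locale ring_morph =
  fixes h :: "'a::comm_ring_1 \<Rightarrow> 'b::comm_ring_1"
  assumes one: "h 1 = 1"
    and add: "h (p + q) = h p + h q"
    and mult: "h (p * q) = h p * h q"
begin

lemma zero: "h 0 = 0"
  using add [of 0 0] by simp

lemma uminus: "h (- p) = - h p"
  using add [of "- p" p] by (simp add: zero eq_neg_iff_add_eq_0)

lemma power: "h (p ^ k) = h p ^ k"
  by (induction k) (simp_all add: one mult)

lemma sum: "h (sum g A) = (\<Sum>a\<in>A. h (g a))"
  by (induction A rule: infinite_finite_induct) (simp_all add: zero add)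

lemma prod: "h (prod g A) = (\<Prod>a\<in>A. h (g a))"
  by (induction A rule: infinite_finite_induct) (simp_all add: one mult)

end

lemma ring_morph_comp:
  "ring_morph g \<Longrightarrow> ring_morph h \<Longrightarrow> ring_morph (\<lambda>p. g (h p))"
  by (simp add: ring_morph_def)

lemma ring_morph_ratfun_of: "ring_morph (ratfun_of :: 'v::linorder mpoly \<Rightarrow> _)"
  by (simp add: ring_morph_def ratfun_of_1 ratfun_of_add ratfun_of_mult)

lemma ring_morph_mconst: "ring_morph (mconst :: complex \<Rightarrow> 'v mpoly)"
  by (simp add: ring_morph_def mconst_def single_add mult_single flip: single_one)

lemma ring_morph_ratconst: "ring_morph (ratconst :: complex \<Rightarrow> 'v::linorder ratfun)"
  unfolding ratconst_def by (rule ring_morph_comp [OF ring_morph_ratfun_of ring_morph_mconst])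

lemma ring_morph_pCons: "ring_morph (\<lambda>p. [:p:])"
  by (simp add: ring_morph_def one_pCons)

lemma field_morph_eq_0_iff:
  fixes h :: "'a::field \<Rightarrow> 'b::field"
  assumes "ring_morph h"
  shows "h p = 0 \<longleftrightarrow> p = 0"
proof -
  interpret ring_morph h by fact
  show ?thesis
    by (metis mult one zero mult_zero_left right_inverse zero_neq_one)
qed

lemma field_morph_divide:
  fixes h :: "'a::field \<Rightarrow> 'b::field"
  assumes "ring_morph h"
  shows "h (p / q) = h p / h q"
proof (cases "q = 0")
  case True
  then show ?thesis using assms by (simp add: ring_morph.zero)
next
  case False
  interpret ring_morph h by fact
  have "h (p / q) * h q = h p" using False by (simp flip: mult)
  moreover have "h q \<noteq> 0" using False field_morph_eq_0_iff [OF assms] by simp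
  ultimately show ?thesis by (simp add: field_simps)
qed

lemma ring_morph_map_poly:
  fixes h :: "'a::comm_ring_1 \<Rightarrow> 'b::comm_ring_1"
  assumes "ring_morph h"
  shows "ring_morph (map_poly h)"
proof -
  interpret ring_morph h by fact
  show ?thesis
    by unfold_locales
      (auto intro!: poly_eqI simp: coeff_map_poly zero one add mult sum coeff_mult coeff_1)
qed

lemma ring_morph_poly: "ring_morph (\<lambda>P. poly P x)"
  by (simp add: ring_morph_def)

lemma ring_morph_poly_map_poly:
  "ring_morph h \<Longrightarrow> ring_morph (\<lambda>P. poly (map_poly h P) x)"
  by (rule ring_morph_comp [OF ring_morph_poly ring_morph_map_poly])

lemma map_poly_pCons_morph:
  "ring_morph h \<Longrightarrow> map_poly h (pCons a P) = pCons (h a) (map_poly h P)"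
  by (simp add: map_poly_pCons ring_morph.zero)

section \<open>The universal property of polynomial rings\<close>

text \<open>
  The homomorphism out of \<open>k[X\<^sub>v | v \<in> 'v]\<close> determined by its restriction \<open>\<kappa>\<close> to constants and its
  values \<open>x\<close> at the variables. Products range over all variables, and not over the support of
  a monomial, so that exponents can be added pointwise.
\<close>
definition meval :: "(complex \<Rightarrow> 'a::comm_ring_1) \<Rightarrow> ('v::finite \<Rightarrow> 'a) \<Rightarrow> 'v mpoly \<Rightarrow> 'a" where
  "meval \<kappa> x p = (\<Sum>m\<in>Poly_Mapping.keys p.
     \<kappa> (Poly_Mapping.lookup p m) * (\<Prod>i\<in>UNIV. x i ^ Poly_Mapping.lookup m i))"

lemma prod_keys_eq_prod_UNIV:
  fixes x :: "'v::finite \<Rightarrow> 'a::comm_ring_1"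
  shows "(\<Prod>i\<in>Poly_Mapping.keys m. x i ^ Poly_Mapping.lookup m i) =
    (\<Prod>i\<in>UNIV. x i ^ Poly_Mapping.lookup m i)"
  by (rule prod.mono_neutral_left) (auto simp: in_keys_iff)

lemma ratfun_eval_eq_meval: "ratfun_eval = meval ratconst"
  by (intro ext) (simp add: ratfun_eval_def meval_def prod_keys_eq_prod_UNIV)

lemma monom_deg_eq_sum_UNIV:
  fixes m :: "'v::finite \<Rightarrow>\<^sub>0 nat"
  shows "monom_deg m = (\<Sum>i\<in>UNIV. Poly_Mapping.lookup m i)"
  unfolding monom_deg_def by (rule sum.mono_neutral_left) (auto simp: in_keys_iff)

lemma single_eq_mconst_times_mvars:
  fixes m :: "'v::finite \<Rightarrow>\<^sub>0 nat"
  shows "Poly_Mapping.single m c =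
    mconst c * (\<Prod>i\<in>UNIV. mvar i ^ Poly_Mapping.lookup m i)"
proof -
  have "(\<Sum>i\<in>UNIV. Poly_Mapping.single i (Poly_Mapping.lookup m i)) = m"
    by (rule poly_mapping_eqI) (simp add: lookup_sum lookup_single when_def)
  then show ?thesis
    by (simp add: mvar_power mconst_def single_sum_exp [symmetric] mult_single)
qed

lemma mpoly_eq_sum_singles:
  "p = (\<Sum>m\<in>Poly_Mapping.keys p. Poly_Mapping.single m (Poly_Mapping.lookup p m))"
  for p :: "'v mpoly"
  by (rule poly_mapping_eqI) (auto simp: lookup_sum lookup_single when_def in_keys_iff)

lemma meval_superset:
  assumes "ring_morph \<kappa>" "finite S" "Poly_Mapping.keys p \<subseteq> S"
  shows "meval \<kappa> x p =
    (\<Sum>m\<in>S. \<kappa> (Poly_Mapping.lookup p m) * (\<Prod>i\<in>UNIV. x i ^ Poly_Mapping.lookup m i))"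
  unfolding meval_def
  by (rule sum.mono_neutral_left) (use assms in \<open>auto simp: in_keys_iff ring_morph.zero\<close>)

lemma meval_single:
  assumes "ring_morph \<kappa>"
  shows "meval \<kappa> x (Poly_Mapping.single m c) = \<kappa> c * (\<Prod>i\<in>UNIV. x i ^ Poly_Mapping.lookup m i)"
  using meval_superset [OF assms, of "{m}" "Poly_Mapping.single m c" x] by auto

lemma meval_add:
  assumes "ring_morph \<kappa>"
  shows "meval \<kappa> x (p + q) = meval \<kappa> x p + meval \<kappa> x q"
proof -
  let ?S = "Poly_Mapping.keys p \<union> Poly_Mapping.keys q"
  have "finite ?S" "Poly_Mapping.keys (p + q) \<subseteq> ?S"
    using Poly_Mapping.keys_add [of p q] by auto
  then show ?thesis
    by (simp add: meval_superset [OF assms, of ?S] lookup_add ring_morph.add [OF assms]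
        sum.distrib [symmetric] algebra_simps)
qed

lemma meval_sum:
  assumes "ring_morph \<kappa>"
  shows "meval \<kappa> x (sum g A) = (\<Sum>a\<in>A. meval \<kappa> x (g a))"
  by (induction A rule: infinite_finite_induct)
    (simp_all add: meval_add [OF assms] meval_def [of _ _ 0])

lemma ring_morph_meval:
  assumes "ring_morph \<kappa>"
  shows "ring_morph (meval \<kappa> x)"
proof
  show "meval \<kappa> x 1 = 1"
    using meval_single [OF assms, of x 0 1] by (simp add: ring_morph.one [OF assms])
  show "meval \<kappa> x (p + q) = meval \<kappa> x p + meval \<kappa> x q" for p q
    by (rule meval_add [OF assms])
  show "meval \<kappa> x (p * q) = meval \<kappa> x p * meval \<kappa> x q" for p q
  proof -
    let ?l = Poly_Mapping.lookup and ?s = Poly_Mapping.single and ?k = Poly_Mapping.keys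
    have "p * q = (\<Sum>m\<in>?k p. ?s m (?l p m)) * (\<Sum>n\<in>?k q. ?s n (?l q n))"
      using mpoly_eq_sum_singles [of p] mpoly_eq_sum_singles [of q] by simp
    also have "\<dots> = (\<Sum>m\<in>?k p. \<Sum>n\<in>?k q. ?s (m + n) (?l p m * ?l q n))"
      by (simp add: sum_product mult_single)
    also have "meval \<kappa> x \<dots> = (\<Sum>m\<in>?k p. \<Sum>n\<in>?k q.
        (\<kappa> (?l p m) * (\<Prod>i\<in>UNIV. x i ^ ?l m i)) * (\<kappa> (?l q n) * (\<Prod>i\<in>UNIV. x i ^ ?l n i)))"
      by (simp add: meval_sum [OF assms] meval_single [OF assms] ring_morph.mult [OF assms]
          lookup_add power_add prod.distrib mult_ac)
    also have "\<dots> = meval \<kappa> x p * meval \<kappa> x q"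
      by (simp add: meval_def sum_product)
    finally show ?thesis .
  qed
qed

lemma meval_mconst: "ring_morph \<kappa> \<Longrightarrow> meval \<kappa> x (mconst c) = \<kappa> c"
  by (simp add: mconst_def meval_single)

lemma meval_mvar:
  assumes "ring_morph \<kappa>"
  shows "meval \<kappa> x (mvar i) = x i"
proof -
  have "(\<Prod>j\<in>UNIV. x j ^ Poly_Mapping.lookup (Poly_Mapping.single i 1) j) =
      (\<Prod>j\<in>UNIV. if j = i then x j else 1)"
    by (rule prod.cong) (auto simp: lookup_single when_def)
  then show ?thesis
    by (simp add: mvar_def meval_single [OF assms] ring_morph.one [OF assms])
qed

lemma ring_morph_eq_meval:
  fixes h :: "'v::finite mpoly \<Rightarrow> 'a::comm_ring_1"
  assumes "ring_morph h"
  shows "h p = meval (\<lambda>c. h (mconst c)) (\<lambda>i. h (mvar i)) p"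
proof -
  interpret ring_morph h by fact
  have "h p = h (\<Sum>m\<in>Poly_Mapping.keys p. Poly_Mapping.single m (Poly_Mapping.lookup p m))"
    using mpoly_eq_sum_singles [of p] by simp
  then show ?thesis
    by (simp add: meval_def sum single_eq_mconst_times_mvars mult prod power)
qed

text \<open>
  The workhorse for identifying compositions of substitutions, and thereby for producing left
  inverses without inspecting monomials.
\<close>
lemma mpoly_morph_eqI:
  fixes g h :: "'v::finite mpoly \<Rightarrow> 'a::comm_ring_1"
  assumes "ring_morph g" "ring_morph h"
    and "\<And>c. g (mconst c) = h (mconst c)" "\<And>i. g (mvar i) = h (mvar i)"
  shows "g p = h p"
  using assms ring_morph_eq_meval [of g p] ring_morph_eq_meval [of h p] by simp

section \<open>Homomorphisms of rational function fields\<close>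

lemma ratfun_cases:
  fixes z :: "'v::linorder ratfun"
  obtains p q where "q \<noteq> 0" "z = ratfun_of p / ratfun_of q"
proof (cases z)
  case (Fract a b)
  then show ?thesis using that [of b a] by (simp add: ratfun_of_def)
qed

lemma ratfun_of_eq_0_iff: "ratfun_of p = 0 \<longleftrightarrow> p = 0"
  using ratfun_of_inject [of p 0] by (simp add: ratfun_of_0)

lemma algebra_hom_iff:
  "algebra_hom \<phi> \<longleftrightarrow> ring_morph \<phi> \<and> (\<forall>c. \<phi> (ratconst c) = ratconst c)"
  unfolding algebra_hom_def ring_morph_def by (metis mult.right_neutral)

lemma algebra_hom_ring_morph: "algebra_hom \<phi> \<Longrightarrow> ring_morph \<phi>"
  by (simp add: algebra_hom_iff)

lemma algebra_hom_ratconst: "algebra_hom \<phi> \<Longrightarrow> \<phi> (ratconst c) = ratconst c"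
  by (simp add: algebra_hom_iff)

lemma algebra_hom_comp:
  "algebra_hom \<phi> \<Longrightarrow> algebra_hom \<psi> \<Longrightarrow> algebra_hom (\<lambda>z. \<phi> (\<psi> z))"
  by (simp add: algebra_hom_iff ring_morph_comp)

lemma algebra_hom_ratfun_of:
  fixes \<phi> :: "'v::{finite,linorder} ratfun \<Rightarrow> 'w::{finite,linorder} ratfun"
  assumes "algebra_hom \<phi>"
  shows "\<phi> (ratfun_of p) = ratfun_eval (\<lambda>i. \<phi> (ratfun_of (mvar i))) p"
  using ring_morph_eq_meval [OF ring_morph_comp [OF algebra_hom_ring_morph [OF assms]
        ring_morph_ratfun_of], of p] algebra_hom_ratconst [OF assms]
  by (simp add: ratfun_eval_eq_meval ratconst_def [symmetric])

text \<open>
  A homomorphism from a domain to a field extends to the fraction field exactly when it is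
  injective. Here injectivity says that the images of the variables are algebraically independent.
\<close>
lemma morph_extends_to_ratfun:
  fixes e :: "'v::{finite,linorder} mpoly \<Rightarrow> 'w::{finite,linorder} ratfun"
  assumes e: "ring_morph e" and const: "\<And>c. e (mconst c) = ratconst c"
    and inj: "\<And>p. e p = 0 \<Longrightarrow> p = 0"
  obtains \<phi> where "algebra_hom \<phi>" "\<And>p. \<phi> (ratfun_of p) = e p"
proof -
  interpret ring_morph e by fact
  have nz: "e q \<noteq> 0" if "q \<noteq> 0" for q using inj that by blast
  have wd: "e p / e q = e p' / e q'"
    if "q \<noteq> 0" "q' \<noteq> 0" "ratfun_of p / ratfun_of q = ratfun_of p' / ratfun_of q'" for p q p' q'
  proof -
    have "p * q' = p' * q"
      using that by (simp add: frac_eq_eq ratfun_of_eq_0_iff flip: ratfun_of_mult)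
        (simp add: ratfun_of_inject)
    then have "e p * e q' = e p' * e q" by (simp flip: mult)
    then show ?thesis using that nz by (simp add: frac_eq_eq)
  qed
  \<comment> \<open>Any representation as a quotient gives the same value, by \<open>wd\<close>.\<close>
  define \<phi> where "\<phi> z = (SOME w. \<exists>p q. q \<noteq> 0 \<and> z = ratfun_of p / ratfun_of q \<and> w = e p / e q)" for z
  have val: "\<phi> (ratfun_of p / ratfun_of q) = e p / e q" if "q \<noteq> 0" for p q
  proof -
    have "\<exists>p' q'. q' \<noteq> 0 \<and> ratfun_of p / ratfun_of q = ratfun_of p' / ratfun_of q' \<and>
        \<phi> (ratfun_of p / ratfun_of q) = e p' / e q'"
      unfolding \<phi>_def by (rule someI_ex) (use that in blast)
    then show ?thesis using wd that by metis
  qed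
  have of: "\<phi> (ratfun_of p) = e p" for p
    using val [of 1 p] by (simp add: ratfun_of_1 one)
  have "ring_morph \<phi>"
  proof
    show "\<phi> 1 = 1" using of [of 1] by (simp add: ratfun_of_1 one)
  next
    fix y z :: "'v ratfun"
    obtain p q where y: "q \<noteq> 0" "y = ratfun_of p / ratfun_of q" by (rule ratfun_cases)
    obtain p' q' where z: "q' \<noteq> 0" "z = ratfun_of p' / ratfun_of q'" by (rule ratfun_cases)
    have qq: "q * q' \<noteq> 0" using y z by simp
    have 1: "y + z = ratfun_of (p * q' + p' * q) / ratfun_of (q * q')"
      using y z by (simp add: ratfun_of_add ratfun_of_mult add_frac_eq ratfun_of_eq_0_iff)
    have 2: "y * z = ratfun_of (p * p') / ratfun_of (q * q')"
      using y z by (simp add: ratfun_of_mult)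
    show "\<phi> (y + z) = \<phi> y + \<phi> z"
      unfolding 1 val [OF qq] unfolding y(2) z(2) val [OF y(1)] val [OF z(1)]
      using nz y(1) z(1) by (simp add: add mult add_frac_eq)
    show "\<phi> (y * z) = \<phi> y * \<phi> z"
      unfolding 2 val [OF qq] unfolding y(2) z(2) val [OF y(1)] val [OF z(1)]
      by (simp add: mult)
  qed
  moreover have "\<phi> (ratconst c) = ratconst c" for c
    using of [of "mconst c"] const by (simp add: ratconst_def)
  ultimately show ?thesis using that [OF _ of] by (simp add: algebra_hom_iff)
qed

text \<open>
  If \<open>\<phi>\<close> makes \<open>g\<close> a square then \<open>\<phi> \<circ> \<alpha>\<close> makes \<open>f\<close> a square.
\<close>
lemma sqrt_rationalizable_transfer:
  fixes f g :: "'v::{finite,linorder} mpoly"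
  assumes "sqrt_rationalizable g" "algebra_hom \<alpha>"
    and "\<alpha> (ratfun_of f) = u ^ 2 * ratfun_of g"
  shows "sqrt_rationalizable f"
proof -
  obtain \<phi> :: "'v ratfun \<Rightarrow> 'v ratfun" and h
    where \<phi>: "algebra_hom \<phi>" "\<phi> (ratfun_of g) = h ^ 2"
    using assms(1) by (auto simp: sqrt_rationalizable_def)
  interpret ring_morph \<phi> using \<phi>(1) by (rule algebra_hom_ring_morph)
  have "\<phi> (\<alpha> (ratfun_of f)) = (\<phi> u * h) ^ 2"
    by (simp add: assms(3) mult power \<phi>(2) power_mult_distrib)
  then show ?thesis
    unfolding sqrt_rationalizable_def using algebra_hom_comp [OF \<phi>(1) assms(2)] by blast
qed

section \<open>Adjoining a variable\<close>

text \<open>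
  The isomorphism \<open>k[x\<^sub>0, \<dots>, x\<^sub>n] \<cong> k[x\<^sub>1, \<dots>, x\<^sub>n][x\<^sub>0]\<close>: \<open>as_poly\<close> and \<open>of_poly\<close> are its two
  directions, and \<open>add_var\<close> is the inclusion of the coefficient ring.
\<close>
definition add_var :: "'n::finite mpoly \<Rightarrow> 'n option mpoly" where
  "add_var = meval mconst (\<lambda>i. mvar (Some i))"

definition as_poly :: "'n::finite option mpoly \<Rightarrow> 'n mpoly poly" where
  "as_poly = meval (\<lambda>c. [:mconst c:]) (case_option [:0, 1:] (\<lambda>i. [:mvar i:]))"

definition of_poly :: "'n::finite mpoly poly \<Rightarrow> 'n option mpoly" where
  "of_poly P = poly (map_poly add_var P) (mvar None)"

lemma ring_morph_add_var: "ring_morph add_var"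
  unfolding add_var_def by (rule ring_morph_meval [OF ring_morph_mconst])

lemma ring_morph_const_poly: "ring_morph (\<lambda>c. [:mconst c:])"
  by (rule ring_morph_comp [OF ring_morph_pCons ring_morph_mconst])

lemma ring_morph_as_poly: "ring_morph as_poly"
  unfolding as_poly_def by (rule ring_morph_meval [OF ring_morph_const_poly])

lemma ring_morph_of_poly: "ring_morph of_poly"
  unfolding of_poly_def by (rule ring_morph_poly_map_poly [OF ring_morph_add_var])

lemma add_var_simps [simp]:
  "add_var (mconst c) = mconst c" "add_var (mvar i) = mvar (Some i)"
  by (simp_all add: add_var_def meval_mconst meval_mvar ring_morph_mconst)

lemma as_poly_simps [simp]:
  "as_poly (mconst c) = [:mconst c:]" "as_poly (mvar None) = [:0, 1:]"
  "as_poly (mvar (Some i)) = [:mvar i:]"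
  by (simp_all add: as_poly_def meval_mconst meval_mvar ring_morph_const_poly)

lemma of_poly_pCons: "of_poly (pCons a P) = add_var a + mvar None * of_poly P"
  by (simp add: of_poly_def map_poly_pCons_morph ring_morph_add_var)

lemma of_poly_0 [simp]: "of_poly 0 = 0"
  by (rule ring_morph.zero [OF ring_morph_of_poly])

lemma add_var_0_1 [simp]: "add_var 0 = 0" "add_var 1 = 1"
  by (simp_all add: ring_morph.zero ring_morph.one ring_morph_add_var)

lemma of_poly_as_poly: "of_poly (as_poly p) = p"
proof (rule mpoly_morph_eqI [where h = "\<lambda>p. p"])
  show "of_poly (as_poly (mvar i)) = mvar i" for i :: "'a option"
    by (cases i) (simp_all add: of_poly_pCons)
qed (simp_all add: ring_morph_comp ring_morph_of_poly ring_morph_as_poly of_poly_pCons,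
     simp add: ring_morph_def)

lemma as_poly_add_var: "as_poly (add_var p) = [:p:]"
  by (rule mpoly_morph_eqI [where h = "\<lambda>p. [:p:]"])
    (simp_all add: ring_morph_comp [OF ring_morph_as_poly ring_morph_add_var] ring_morph_pCons)

lemma as_poly_of_poly: "as_poly (of_poly P) = P"
  by (induction P)
    (simp_all add: of_poly_pCons ring_morph.zero ring_morph.add ring_morph.mult
      ring_morph_as_poly as_poly_add_var)

lemma ratfun_add_var:
  obtains \<iota> :: "'n::{finite,linorder} ratfun \<Rightarrow> 'n option ratfun"
  where "algebra_hom \<iota>" "\<And>p. \<iota> (ratfun_of p) = ratfun_of (add_var p)"
proof (rule morph_extends_to_ratfun [of "\<lambda>p. ratfun_of (add_var p) :: 'n option ratfun"])
  show "ring_morph (\<lambda>p. ratfun_of (add_var p) :: 'n option ratfun)"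
    by (rule ring_morph_comp [OF ring_morph_ratfun_of ring_morph_add_var])
  show "p = 0" if "ratfun_of (add_var p) = (0 :: 'n option ratfun)" for p :: "'n mpoly"
  proof -
    have "add_var p = 0" using that by (simp add: ratfun_of_eq_0_iff)
    then show ?thesis using as_poly_add_var [of p] by (simp add: ring_morph.zero ring_morph_as_poly)
  qed
qed (auto simp: ratconst_def)

lemma map_poly_map_poly_morph:
  assumes "ring_morph g" "ring_morph h"
  shows "map_poly g (map_poly h P) = map_poly (\<lambda>x. g (h x)) P"
  by (rule poly_eqI) (simp add: coeff_map_poly ring_morph.zero assms)

lemma map_poly_morph_eq_0D:
  assumes "ring_morph h" "\<And>x. h x = 0 \<Longrightarrow> x = 0" "map_poly h P = 0"
  shows "P = 0"
proof (rule poly_eqI)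
  fix n
  have "h (coeff P n) = coeff (map_poly h P) n"
    by (simp add: coeff_map_poly ring_morph.zero assms(1))
  then show "coeff P n = coeff 0 n" using assms by simp
qed

lemma clear_denominators_poly:
  fixes P :: "'v::linorder ratfun poly"
  shows "\<exists>w R. w \<noteq> 0 \<and> smult (ratfun_of w) P = map_poly ratfun_of R"
proof (induction P)
  case 0
  show ?case by (intro exI [of _ 1] exI [of _ 0]) simp
next
  case (pCons a P)
  then obtain w R where w: "w \<noteq> 0" "smult (ratfun_of w) P = map_poly ratfun_of R" by blast
  obtain u v where a: "v \<noteq> 0" "a = ratfun_of u / ratfun_of v" by (rule ratfun_cases)
  have "map_poly ratfun_of (smult v R) = smult (ratfun_of v) (map_poly ratfun_of R)"
    by (rule poly_eqI) (simp add: coeff_map_poly ratfun_of_0 ratfun_of_mult)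
  then have "smult (ratfun_of (w * v)) (pCons a P) = map_poly ratfun_of (pCons (w * u) (smult v R))"
    using a w(2) by (simp add: map_poly_pCons_morph ring_morph_ratfun_of ratfun_of_mult
        ratfun_of_eq_0_iff mult.commute [of "ratfun_of w" "ratfun_of v"]
        flip: smult_smult)
  then show ?case using w(1) a(1) by (metis mult_eq_0_iff)
qed

lemma common_denominator:
  fixes z :: "'i::finite \<Rightarrow> 'v::linorder ratfun"
  obtains p q where "q \<noteq> 0" "\<And>i. z i = ratfun_of (p i) / ratfun_of q"
proof -
  have "\<forall>i. \<exists>u v. v \<noteq> 0 \<and> z i = ratfun_of u / ratfun_of v"
    using ratfun_cases by metis
  then obtain u v where uv: "\<And>i. v i \<noteq> 0" "\<And>i. z i = ratfun_of (u i) / ratfun_of (v i)"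
    by metis
  have "z i = ratfun_of (u i * prod v (UNIV - {i})) / ratfun_of (prod v UNIV)" for i
  proof -
    have "prod v UNIV = v i * prod v (UNIV - {i})"
      by (rule prod.remove) simp_all
    moreover have "prod v (UNIV - {i}) \<noteq> 0" using uv(1) by simp
    ultimately show ?thesis
      using uv by (simp add: ratfun_of_mult ratfun_of_eq_0_iff)
  qed
  moreover have "prod v UNIV \<noteq> 0" using uv(1) by simp
  ultimately show ?thesis
    using that [of "prod v UNIV" "\<lambda>i. u i * prod v (UNIV - {i})"] by blast
qed

section \<open>Transcendental elements over the image of a field\<close>

text \<open>
  For a homomorphism \<open>h\<close> from a field \<open>K\<close> to a field this says that \<open>s\<close> is
  transcendental over the subfield \<open>h(K)\<close>. Passing to a homomorphism \<open>h\<close> instead of a subfield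
  makes the target a vector space over the type \<open>K\<close>.
\<close>
definition transcendental :: "('a::comm_ring_1 \<Rightarrow> 'b::comm_ring_1) \<Rightarrow> 'b \<Rightarrow> bool" where
  "transcendental h s \<longleftrightarrow> (\<forall>P. poly (map_poly h P) s = 0 \<longrightarrow> P = 0)"

text \<open>
  After clearing denominators a relation for \<open>x\<^sub>0\<close> becomes an element of \<open>k[x\<^sub>1, \<dots>, x\<^sub>n][x\<^sub>0]\<close> that
  vanishes in \<open>k[x\<^sub>0, \<dots>, x\<^sub>n]\<close>, and these two rings are isomorphic.
\<close>
lemma transcendental_new_variable:
  fixes \<iota> :: "'n::{finite,linorder} ratfun \<Rightarrow> 'n option ratfun"
  assumes \<iota>: "algebra_hom \<iota>" "\<And>p. \<iota> (ratfun_of p) = ratfun_of (add_var p)"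
  shows "transcendental \<iota> (ratfun_of (mvar None))"
  unfolding transcendental_def
proof (intro allI impI)
  fix P assume P: "poly (map_poly \<iota> P) (ratfun_of (mvar None)) = 0"
  note hom = algebra_hom_ring_morph [OF \<iota>(1)]
  obtain w R where w: "w \<noteq> 0" "smult (ratfun_of w) P = map_poly ratfun_of R"
    using clear_denominators_poly by blast
  have eval: "poly (map_poly \<iota> (map_poly ratfun_of R)) (ratfun_of (mvar None)) = ratfun_of (of_poly R)"
    for R
  proof (induction R)
    case 0 then show ?case by (simp add: ratfun_of_0)
  next
    case (pCons a R)
    then show ?case
      by (simp add: map_poly_pCons_morph ring_morph_ratfun_of hom of_poly_pCons \<iota>(2)
          ratfun_of_add ratfun_of_mult)
  qed
  have "poly (map_poly \<iota> (smult (ratfun_of w) P)) (ratfun_of (mvar None)) =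
      \<iota> (ratfun_of w) * poly (map_poly \<iota> P) (ratfun_of (mvar None))"
  proof -
    have "map_poly \<iota> (smult (ratfun_of w) P) = smult (\<iota> (ratfun_of w)) (map_poly \<iota> P)"
      by (rule poly_eqI) (simp add: coeff_map_poly ring_morph.zero ring_morph.mult hom)
    then show ?thesis by simp
  qed
  then have "of_poly R = 0" using P w(2) eval [of R] by (simp add: ratfun_of_eq_0_iff)
  then have "R = 0" using as_poly_of_poly [of R] by (simp add: ring_morph.zero ring_morph_as_poly)
  then show "P = 0" using w by (simp add: ratfun_of_eq_0_iff)
qed

text \<open>
  If \<open>\<phi>\<close> makes \<open>f\<close> a square, apply \<open>\<phi>\<close> to the coefficients of a polynomial in \<open>x\<^sub>0\<close> and keep \<open>x\<^sub>0\<close>.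
  This is injective, hence extends to \<open>k(x\<^sub>0, \<dots>, x\<^sub>n)\<close>, since \<open>x\<^sub>0\<close> is transcendental over
  \<open>k(x\<^sub>1, \<dots>, x\<^sub>n)\<close>.
\<close>
lemma sqrt_rationalizable_add_var:
  fixes f :: "'n::{finite,linorder} mpoly"
  assumes "sqrt_rationalizable f"
  shows "sqrt_rationalizable (add_var f)"
proof -
  obtain \<phi> :: "'n ratfun \<Rightarrow> 'n ratfun" and h
    where \<phi>: "algebra_hom \<phi>" "\<phi> (ratfun_of f) = h ^ 2"
    using assms by (auto simp: sqrt_rationalizable_def)
  obtain \<iota> :: "'n ratfun \<Rightarrow> 'n option ratfun"
    where \<iota>: "algebra_hom \<iota>" "\<And>p. \<iota> (ratfun_of p) = ratfun_of (add_var p)"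
    using ratfun_add_var by blast
  note hom = algebra_hom_ring_morph [OF \<phi>(1)] algebra_hom_ring_morph [OF \<iota>(1)]
  define c where "c = (\<lambda>u. \<phi> (ratfun_of u))"
  have c: "ring_morph c" unfolding c_def by (rule ring_morph_comp [OF hom(1) ring_morph_ratfun_of])
  have c\<iota>: "ring_morph (\<lambda>u. \<iota> (c u))" by (rule ring_morph_comp [OF hom(2) c])
  define e where "e P = poly (map_poly (\<lambda>u. \<iota> (c u)) (as_poly P)) (ratfun_of (mvar None))" for P
  have e: "ring_morph e"
    unfolding e_def by (rule ring_morph_comp [OF ring_morph_poly_map_poly [OF c\<iota>] ring_morph_as_poly])
  have e_add_var: "e (add_var u) = \<iota> (c u)" for u
    by (simp add: e_def as_poly_add_var map_poly_pCons_morph c\<iota>)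
  have const: "c (mconst a) = ratconst a" for a
    using algebra_hom_ratconst [OF \<phi>(1), of a] by (simp add: c_def ratconst_def)
  have "e (mconst a) = ratconst a" for a
    using e_add_var [of "mconst a"] algebra_hom_ratconst [OF \<iota>(1), of a] by (simp add: const)
  moreover have "P = 0" if "e P = 0" for P
  proof -
    have "map_poly c (as_poly P) = 0"
      using that transcendental_new_variable [OF \<iota>]
      by (simp add: e_def transcendental_def flip: map_poly_map_poly_morph [OF hom(2) c])
    then have "as_poly P = 0"
      by (rule map_poly_morph_eq_0D [OF c, rotated])
        (simp add: c_def field_morph_eq_0_iff [OF hom(1)] ratfun_of_eq_0_iff)
    then show ?thesis using of_poly_as_poly [of P] by simp
  qed
  ultimately obtain \<Phi> where \<Phi>: "algebra_hom \<Phi>" "\<And>P. \<Phi> (ratfun_of P) = e P"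
    using morph_extends_to_ratfun [OF e] by blast
  have "\<Phi> (ratfun_of (add_var f)) = \<iota> h ^ 2"
    by (simp add: \<Phi>(2) e_add_var c_def \<phi>(2) ring_morph.power [OF hom(2)])
  then show ?thesis using \<Phi>(1) unfolding sqrt_rationalizable_def by blast
qed

text \<open>
  If every variable is algebraic over \<open>K = \<psi>('k)\<close>, the monomials, and with them all polynomials, lie
  in a \<open>K\<close>-vector space spanned by a finite set \<open>B\<close>. For \<open>s = p/q\<close> and \<open>M = |B|\<close> the \<open>M + 1\<close> polynomials
  \<open>p\<^sup>k q\<^bsup>M-k\<^esup> = q\<^sup>M s\<^sup>k\<close> with \<open>k \<le> M\<close> are then linearly dependent over \<open>K\<close>, and dividing by \<open>q\<^sup>M\<close>
  gives an algebraic equation for \<open>s\<close>. 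
\<close>
lemma algebraic_of_algebraic_variables:
  fixes \<psi> :: "'k::field \<Rightarrow> 'v::{finite,linorder} ratfun"
  assumes \<psi>: "ring_morph \<psi>" and const: "\<And>c. ratconst c \<in> range \<psi>"
    and alg: "\<And>i. \<not> transcendental \<psi> (ratfun_of (mvar i))"
  shows "\<not> transcendental \<psi> s"
proof
  assume s: "transcendental \<psi> s"
  interpret \<psi>: ring_morph \<psi> by fact
  interpret V: vector_space "\<lambda>k v. \<psi> k * v"
    by unfold_locales (simp_all add: algebra_simps \<psi>.add \<psi>.mult \<psi>.one)
  have span_mult: "u * v \<in> V.span {a * b |a b. a \<in> A \<and> b \<in> B}"
    if u: "u \<in> V.span A" and v: "v \<in> V.span B" for u v A B
  proof -
    let ?C = "V.span {a * b |a b. a \<in> A \<and> b \<in> B}"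
    have 1: "a * v \<in> ?C" if a: "a \<in> A" for a
      using v
    proof (induction rule: V.span_induct_alt)
      case base show ?case by (simp add: V.span_zero)
    next
      case (step c x y)
      have "a * (\<psi> c * x + y) = \<psi> c * (a * x) + a * y" by (simp add: algebra_simps)
      moreover have "a * x \<in> ?C" using a step by (intro V.span_base) blast
      ultimately show ?case using step by (simp add: V.span_add V.span_scale)
    qed
    show ?thesis
      using u
    proof (induction rule: V.span_induct_alt)
      case base show ?case by (simp add: V.span_zero)
    next
      case (step c x y)
      have "(\<psi> c * x + y) * v = \<psi> c * (x * v) + y * v" by (simp add: algebra_simps)
      then show ?case using step 1 by (simp add: V.span_add V.span_scale)
    qed
  qed
  have power_span: "\<exists>B. finite B \<and> (\<forall>k. ratfun_of (mvar i) ^ k \<in> V.span B)" for i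
  proof -
    define x :: "'v ratfun" where "x = ratfun_of (mvar i)"
    obtain P where P: "P \<noteq> 0" "poly (map_poly \<psi> P) x = 0"
      using alg [of i] by (auto simp: transcendental_def x_def)
    define D where "D = degree P"
    have l: "\<psi> (lead_coeff P) \<noteq> 0" using P by (simp add: field_morph_eq_0_iff [OF \<psi>])
    \<comment> \<open>The equation rewrites \<open>x\<^sup>D\<close>, hence every power of \<open>x\<close>, in terms of lower powers.\<close>
    let ?B = "(\<lambda>k. x ^ k) ` {..<D}"
    have deg: "degree (map_poly \<psi> P) = D"
      unfolding D_def by (rule map_poly_degree_eq) (use l in simp)
    have "(\<Sum>k\<le>D. \<psi> (coeff P k) * x ^ k) = 0"
      using P(2) by (simp add: poly_altdef deg coeff_map_poly \<psi>.zero)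
    then have "\<psi> (coeff P D) * x ^ D = - (\<Sum>k<D. \<psi> (coeff P k) * x ^ k)"
      by (simp add: eq_neg_iff_add_eq_0 add.commute flip: lessThan_Suc_atMost)
    then have "\<psi> (coeff P D) * x ^ D \<in> V.span ?B"
      by (simp only:) (intro V.span_neg V.span_sum V.span_scale V.span_base imageI)
    then have "\<psi> (inverse (coeff P D)) * (\<psi> (coeff P D) * x ^ D) \<in> V.span ?B"
      by (rule V.span_scale)
    then have top: "x ^ D \<in> V.span ?B"
      using P(1) by (simp add: D_def \<psi>.one flip: mult.assoc \<psi>.mult)
    have "x ^ k \<in> V.span ?B" for k
    proof (induction k)
      case 0
      show ?case
      proof (cases "D = 0")
        case True then show ?thesis using top by simp
      next
        case False
        then show ?thesis by (intro V.span_base) (auto intro!: image_eqI [of _ _ 0])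
      qed
    next
      case (Suc k)
      then show ?case
        unfolding power_Suc
      proof (induction rule: V.span_induct_alt)
        case base show ?case by (simp add: V.span_zero)
      next
        case (step c y z)
        then obtain l where l: "y = x ^ l" "l < D" by auto
        have "x * y \<in> V.span ?B"
        proof (cases "Suc l = D")
          case True then show ?thesis using top l by auto
        next
          case False
          then have "Suc l < D" using l by simp
          then show ?thesis
            using l by (intro V.span_base) (auto intro!: image_eqI [of _ _ "Suc l"])
        qed
        moreover have "x * (\<psi> c * y + z) = \<psi> c * (x * y) + x * z" by (simp add: algebra_simps)
        ultimately show ?case using step by (simp add: V.span_add V.span_scale)
      qed
    qed
    then show ?thesis unfolding x_def by (intro exI [of _ ?B]) (auto simp: x_def)
  qed
  have monom_span: "\<exists>B. finite B \<and>
      (\<forall>m. (\<Prod>i\<in>A. ratfun_of (mvar i) ^ m i) \<in> V.span B)" if "finite A" for A :: "'v set"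
    using that
  proof (induction A)
    case empty
    then show ?case by (intro exI [of _ "{1}"]) (simp add: V.span_base)
  next
    case (insert i A)
    obtain B where B: "finite B" "\<And>m. (\<Prod>i\<in>A. ratfun_of (mvar i) ^ m i) \<in> V.span B"
      using insert by blast
    obtain C where C: "finite C" "\<And>k. ratfun_of (mvar i) ^ k \<in> V.span C"
      using power_span by blast
    let ?D = "{a * b |a b. a \<in> C \<and> b \<in> B}"
    have "finite ?D" using B(1) C(1) by (simp add: finite_image_set2)
    moreover have "\<forall>m. (\<Prod>i\<in>insert i A. ratfun_of (mvar i) ^ m i) \<in> V.span ?D"
      using span_mult [OF C(2) B(2)] insert by simp
    ultimately show ?case by blast
  qed
  obtain B where B: "finite B" "\<And>m. (\<Prod>i\<in>UNIV. ratfun_of (mvar i) ^ m i) \<in> V.span B"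
    using monom_span [of UNIV] by auto
  have poly_span: "ratfun_of p \<in> V.span B" for p
  proof -
    have c: "ratconst c * y \<in> V.span B" if "y \<in> V.span B" for c y
    proof -
      obtain k where "ratconst c = \<psi> k" using const [of c] by auto
      then show ?thesis using that by (simp add: V.span_scale)
    qed
    have "ratfun_of p = meval ratconst (\<lambda>i. ratfun_of (mvar i)) p"
      using ring_morph_eq_meval [OF ring_morph_ratfun_of, of p] by (simp add: ratconst_def [symmetric])
    then show ?thesis unfolding meval_def by (simp only:) (intro V.span_sum c B(2))
  qed
  obtain p q where q: "q \<noteq> 0" "s = ratfun_of p / ratfun_of q" by (rule ratfun_cases)
  define M where "M = card B"
  define v :: "nat \<Rightarrow> 'v ratfun" where "v k = ratfun_of (p ^ k * q ^ (M - k))" for k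
  have v: "v k = ratfun_of q ^ M * s ^ k" if "k \<le> M" for k
  proof -
    have "ratfun_of q ^ M = ratfun_of q ^ (M - k) * ratfun_of q ^ k"
      using that by (simp flip: power_add)
    then show ?thesis
      using q by (simp add: v_def ratfun_of_mult ratfun_of_power power_divide ratfun_of_eq_0_iff)
  qed
  have indep: "c k = 0" if "(\<Sum>k\<le>M. \<psi> (c k) * v k) = 0" "k \<le> M" for c k
  proof -
    define P where "P = (\<Sum>k\<le>M. monom (c k) k)"
    have "(\<Sum>k\<le>M. \<psi> (c k) * v k) = ratfun_of q ^ M * (\<Sum>k\<le>M. \<psi> (c k) * s ^ k)"
      by (simp add: v sum_distrib_left mult_ac)
    then have "(\<Sum>k\<le>M. \<psi> (c k) * s ^ k) = 0" using that(1) q(1) by (simp add: ratfun_of_eq_0_iff)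
    moreover have "poly (map_poly \<psi> P) s = (\<Sum>k\<le>M. \<psi> (c k) * s ^ k)"
      unfolding P_def
      by (simp add: ring_morph.sum [OF ring_morph_map_poly [OF \<psi>]] poly_sum map_poly_monom
          \<psi>.zero poly_monom)
    ultimately have "P = 0" using s by (simp add: transcendental_def)
    moreover have "coeff P k = c k" using that(2) by (simp add: P_def coeff_sum)
    ultimately show ?thesis by simp
  qed
  have inj: "inj_on v {..M}"
  proof (rule inj_onI, rule ccontr)
    fix k l assume kl: "k \<in> {..M}" "l \<in> {..M}" "v k = v l" "k \<noteq> l"
    define c where "c i = (if i = k then 1 else if i = l then - 1 else (0::'k))" for i
    have "(\<Sum>i\<le>M. \<psi> (c i) * v i) = (\<Sum>i\<in>{k, l}. \<psi> (c i) * v i)"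
      by (rule sum.mono_neutral_right) (use kl in \<open>auto simp: c_def \<psi>.zero\<close>)
    also have "\<dots> = 0" using kl by (simp add: c_def \<psi>.one \<psi>.uminus)
    finally have "c k = 0" using indep kl by auto
    then show False by (simp add: c_def)
  qed
  have "\<not> V.dependent (v ` {..M})"
  proof
    assume "V.dependent (v ` {..M})"
    then obtain u where u: "\<exists>w\<in>v ` {..M}. u w \<noteq> 0" "(\<Sum>w\<in>v ` {..M}. \<psi> (u w) * w) = 0"
      by (auto simp: V.dependent_finite)
    have "(\<Sum>k\<le>M. \<psi> (u (v k)) * v k) = 0" using u(2) by (simp add: sum.reindex [OF inj])
    then have "\<forall>k\<le>M. u (v k) = 0" using indep [of "\<lambda>k. u (v k)"] by blast
    then show False using u(1) by auto
  qed
  moreover have "v ` {..M} \<subseteq> V.span B" unfolding v_def using poly_span by auto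
  ultimately have "card (v ` {..M}) \<le> card B" using V.independent_span_bound [OF B(1)] by blast
  then show False unfolding card_image [OF inj] by (simp add: M_def)
qed


lemma transcendental_image:
  fixes g :: "'b::field \<Rightarrow> 'c::field"
  assumes "ring_morph g" "ring_morph h" "transcendental h s"
  shows "transcendental (\<lambda>x. g (h x)) (g s)"
  unfolding transcendental_def
proof (intro allI impI)
  fix P assume P: "poly (map_poly (\<lambda>x. g (h x)) P) (g s) = 0"
  have "poly (map_poly g R) (g s) = g (poly R s)" for R
    by (induction R)
      (simp_all add: map_poly_pCons_morph ring_morph.zero ring_morph.add ring_morph.mult assms(1))
  then have "g (poly (map_poly h P) s) = 0"
    using P by (simp flip: map_poly_map_poly_morph [OF assms(1,2)])
  then show "P = 0"
    using assms(3) by (simp add: field_morph_eq_0_iff [OF assms(1)] transcendental_def)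
qed

section \<open>Linear independence under specialization\<close>

text \<open>
  The vectors \<open>g m\<close>, with entries \<open>g m e\<close> in \<open>k[t]\<close>, are linearly independent over \<open>k[t]\<close>; then their
  values at \<open>t = c\<close> are linearly independent over \<open>k\<close> for all but finitely many \<open>c\<close>. This is Gaussian
  elimination: a nonzero entry \<open>p\<close> of one vector clears its column in all the others, and outside
  the finitely many roots of \<open>p\<close> the elimination step commutes with specialization and can be
  undone.
\<close>
lemma finite_dependent_specializations:
  fixes g :: "'a \<Rightarrow> 'e \<Rightarrow> 'k::idom poly"
  assumes "finite S"
    and "\<And>l m. (\<And>e. (\<Sum>m\<in>S. l m * g m e) = 0) \<Longrightarrow> m \<in> S \<Longrightarrow> l m = 0"
  shows "finite {c. \<exists>\<mu>. (\<forall>e. (\<Sum>m\<in>S. \<mu> m * poly (g m e) c) = 0) \<and> (\<exists>m\<in>S. \<mu> m \<noteq> 0)}"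
  using assms
proof (induction S arbitrary: g)
  case empty
  show ?case by simp
next
  case (insert r S)
  note S = insert.hyps and indep = insert.prems
  have split: "(\<Sum>m\<in>insert r S. x m) = x r + (\<Sum>m\<in>S. x m)" for x :: "'a \<Rightarrow> 'b::comm_monoid_add"
    using S by simp
  obtain e0 where e0: "g r e0 \<noteq> 0"
  proof (rule ccontr)
    assume "\<not> thesis"
    then have "g r e = 0" for e using that by blast
    then have "(\<Sum>m\<in>insert r S. (if m = r then 1 else 0) * g m e) = 0" for e
      by (intro sum.neutral) auto
    then show False using indep [of "\<lambda>m. if m = r then 1 else 0" r] by simp
  qed
  define p where "p = g r e0"
  define g' where "g' m e = p * g m e - g m e0 * g r e" for m e
  have "finite {c. \<exists>\<mu>. (\<forall>e. (\<Sum>m\<in>S. \<mu> m * poly (g' m e) c) = 0) \<and> (\<exists>m\<in>S. \<mu> m \<noteq> 0)}"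
    (is "finite ?B'")
  proof (rule insert.IH)
    fix l n assume l: "\<And>e. (\<Sum>m\<in>S. l m * g' m e) = 0" and n: "n \<in> S"
    \<comment> \<open>A relation between the reduced vectors, written as one between the original vectors.\<close>
    define l' where "l' m = (if m = r then - (\<Sum>m\<in>S. l m * g m e0) else l m * p)" for m
    have "(\<Sum>m\<in>insert r S. l' m * g m e) = 0" for e
    proof -
      have "(\<Sum>m\<in>S. l' m * g m e) = (\<Sum>m\<in>S. l m * p * g m e)"
        by (rule sum.cong) (use S in \<open>auto simp: l'_def\<close>)
      moreover have "(\<Sum>m\<in>S. l m * g' m e) =
          (\<Sum>m\<in>S. l m * p * g m e) - (\<Sum>m\<in>S. l m * g m e0) * g r e"
        by (simp add: g'_def algebra_simps sum_subtractf sum_distrib_left)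
      ultimately show ?thesis using l [of e] by (simp add: split l'_def)
    qed
    then have "l' n = 0" using indep n by blast
    then show "l n = 0" using n S e0 by (auto simp: l'_def p_def split: if_splits)
  qed
  moreover have "finite {c. poly p c = 0}" using e0 by (simp add: p_def poly_roots_finite)
  moreover have "{c. \<exists>\<mu>. (\<forall>e. (\<Sum>m\<in>insert r S. \<mu> m * poly (g m e) c) = 0) \<and>
      (\<exists>m\<in>insert r S. \<mu> m \<noteq> 0)} \<subseteq> ?B' \<union> {c. poly p c = 0}"
  proof (rule subsetI, rule UnCI)
    fix c
    assume "c \<in> {c. \<exists>\<mu>. (\<forall>e. (\<Sum>m\<in>insert r S. \<mu> m * poly (g m e) c) = 0) \<and>
        (\<exists>m\<in>insert r S. \<mu> m \<noteq> 0)}"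
    then obtain \<mu> where \<mu>: "\<And>e. \<mu> r * poly (g r e) c + (\<Sum>m\<in>S. \<mu> m * poly (g m e) c) = 0"
      and nz: "\<mu> r \<noteq> 0 \<or> (\<exists>m\<in>S. \<mu> m \<noteq> 0)" by (auto simp: split)
    assume "c \<notin> {c. poly p c = 0}"
    then have pc: "poly p c \<noteq> 0" by simp
    have "(\<Sum>m\<in>S. \<mu> m * poly (g' m e) c) = 0" for e
    proof -
      have "(\<Sum>m\<in>S. \<mu> m * poly (g' m e) c) = poly p c * (\<Sum>m\<in>S. \<mu> m * poly (g m e) c) -
          (\<Sum>m\<in>S. \<mu> m * poly (g m e0) c) * poly (g r e) c"
        by (simp add: g'_def algebra_simps sum_subtractf sum_distrib_left)
      also have "\<dots> = poly p c * (- (\<mu> r * poly (g r e) c)) - (- (\<mu> r * poly p c)) * poly (g r e) c"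
      proof -
        have "(\<Sum>m\<in>S. \<mu> m * poly (g m e) c) = - (\<mu> r * poly (g r e) c)" for e
          using \<mu> [of e] by (simp add: eq_neg_iff_add_eq_0 add.commute)
        then show ?thesis by (simp add: p_def)
      qed
      finally show ?thesis by (simp add: algebra_simps)
    qed
    moreover have "\<exists>m\<in>S. \<mu> m \<noteq> 0"
    proof (rule ccontr)
      assume "\<not> (\<exists>m\<in>S. \<mu> m \<noteq> 0)"
      then show False using \<mu> [of e0] nz pc by (auto simp: p_def)
    qed
    ultimately show "c \<in> ?B'" by blast
  qed
  ultimately show ?case by (meson finite_UnI finite_subset)
qed

section \<open>Specializing the new variable\<close>

text \<open>
  Besides the substitution \<open>x\<^sub>0 = c\<close>, a polynomial in \<open>x\<^sub>0, \<dots>, x\<^sub>n\<close> is viewed as a vector over \<open>k[x\<^sub>0]\<close>,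
  indexed by the exponents \<open>e\<close> of the monomials in \<open>x\<^sub>1, \<dots>, x\<^sub>n\<close>; \<open>coord e\<close> is its entry at \<open>e\<close>.
  Specializing the polynomial specializes its entries (\<open>poly_coord\<close>).
\<close>
definition specialize :: "complex \<Rightarrow> 'n::finite option mpoly \<Rightarrow> 'n mpoly" where
  "specialize c g = poly (as_poly g) (mconst c)"

definition coord :: "('n \<Rightarrow>\<^sub>0 nat) \<Rightarrow> 'n::finite option mpoly \<Rightarrow> complex poly" where
  "coord e g = map_poly (\<lambda>u. Poly_Mapping.lookup u e) (as_poly g)"

lemma ring_morph_specialize: "ring_morph (specialize c)"
  unfolding specialize_def by (rule ring_morph_comp [OF ring_morph_poly ring_morph_as_poly])

lemma specialize_mconst: "specialize c (mconst a) = mconst a"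
  by (simp add: specialize_def)

lemma lookup_mconst_mult:
  "Poly_Mapping.lookup (mconst c * u) e = c * Poly_Mapping.lookup u e"
proof -
  have "mconst c * u = Poly_Mapping.map ((*) c) u"
    by (simp add: mconst_def mult_map_scale_conv_mult)
  then show ?thesis by (simp add: map.rep_eq when_def)
qed

lemma poly_coord: "poly (coord e g) c = Poly_Mapping.lookup (specialize c g) e"
proof -
  have "poly (map_poly (\<lambda>u. Poly_Mapping.lookup u e) P) c =
      Poly_Mapping.lookup (poly P (mconst c)) e" for P
    by (induction P) (simp_all add: map_poly_pCons lookup_add lookup_mconst_mult)
  then show ?thesis by (simp add: coord_def specialize_def)
qed

text \<open>
  The entries \<open>coord e\<close> are linear over \<open>k[x\<^sub>0]\<close> and jointly injective, so linear relations with
  coefficients in \<open>k[x\<^sub>0]\<close> can be checked entrywise.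
\<close>
lemma coord_combination_eq_0D:
  assumes "\<And>e. (\<Sum>m\<in>S. l m * coord e (g m)) = 0"
  shows "(\<Sum>m\<in>S. of_poly (map_poly mconst (l m)) * g m) = 0"
proof -
  let ?R = "\<Sum>m\<in>S. map_poly mconst (l m) * as_poly (g m)"
  have mc: "mconst (0::complex) = 0" by (simp add: mconst_def)
  have "(\<Sum>m\<in>S. l m * coord e (g m)) = map_poly (\<lambda>u. Poly_Mapping.lookup u e) ?R" for e
    by (rule poly_eqI)
      (simp add: coord_def coeff_map_poly coeff_mult coeff_sum lookup_sum lookup_mconst_mult mc)
  then have R: "map_poly (\<lambda>u. Poly_Mapping.lookup u e) ?R = 0" for e using assms by simp
  have "Poly_Mapping.lookup (coeff ?R n) e = 0" for n e
    using arg_cong [OF R [of e], of "\<lambda>P. coeff P n"] by (simp add: coeff_map_poly)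
  then have "coeff ?R n = 0" for n by (intro poly_mapping_eqI) simp
  then have "?R = 0" by (intro poly_eqI) simp
  then have "of_poly ?R = 0" by simp
  then show ?thesis
    by (simp add: ring_morph.sum ring_morph.mult ring_morph_of_poly of_poly_as_poly)
qed

lemma ratfun_of_of_poly_mconst:
  "ratfun_of (of_poly (map_poly mconst l)) =
    poly (map_poly ratconst l) (ratfun_of (mvar None :: 'n::{finite,linorder} option mpoly))"
  by (induction l)
    (simp_all add: map_poly_pCons_morph ring_morph_mconst ring_morph_ratconst of_poly_pCons
      ratfun_of_0 ratfun_of_add ratfun_of_mult flip: ratconst_def)

text \<open>
  This bounds the number of conditions that the specialization \<open>x\<^sub>0 = c\<close> has to meet.
\<close>
lemma countable_finite_sets_of_exponents: "countable {S :: ('n::finite \<Rightarrow>\<^sub>0 nat) set. finite S}"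
proof -
  have "inj (Poly_Mapping.lookup :: ('n \<Rightarrow>\<^sub>0 nat) \<Rightarrow> _)" by (rule injI, rule poly_mapping_eqI) simp
  then have "countable (UNIV :: ('n \<Rightarrow>\<^sub>0 nat) set)"
    by (rule countableI' [of "to_nat \<circ> Poly_Mapping.lookup", OF inj_compose [OF inj_to_nat]])
  then show ?thesis using countable_Collect_finite_subset [of UNIV] by simp
qed

lemma linear_independent_monomials:
  assumes "finite S" "(\<Sum>m\<in>S. ratconst (a m) * ratfun_of (Poly_Mapping.single m 1)) = 0" "n \<in> S"
  shows "a n = 0"
proof -
  have "ratfun_of (\<Sum>m\<in>S. Poly_Mapping.single m (a m)) = 0"
    using assms(2) by (simp add: ratfun_of_sum ratconst_def mconst_def mult_single flip: ratfun_of_mult)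
  then have "Poly_Mapping.lookup (\<Sum>m\<in>S. Poly_Mapping.single m (a m)) n = 0"
    by (simp add: ratfun_of_eq_0_iff)
  moreover have "Poly_Mapping.lookup (\<Sum>m\<in>S. Poly_Mapping.single m (a m)) n = a n"
    using assms(1,3) by (simp add: lookup_sum lookup_single when_def)
  ultimately show ?thesis by simp
qed

text \<open>
  Write \<open>\<psi>(X\<^sub>i) = p\<^sub>i/q\<close>, and \<open>h\<close> with the same denominator \<open>q\<close>. A monomial
  of degree at most \<open>N\<close> in the fractions \<open>p\<^sub>i/q\<close> becomes a polynomial after multiplication by \<open>q\<^sup>N\<close>, and these
  polynomials are what is specialized at \<open>x\<^sub>0 = c\<close>. They are linearly independent over
  \<open>k[x\<^sub>0]\<close>, because a relation, sorted by powers of \<open>x\<^sub>0\<close>, is an algebraic equation for \<open>x\<^sub>0\<close> over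
  \<open>\<psi>(Q)\<close>. Outside countably many \<open>c\<close> they stay independent over \<open>k\<close> for every finite set of monomials, and
  \<open>q(c) \<noteq> 0\<close>, so the fractions \<open>p\<^sub>i(c)/q(c)\<close> are algebraically independent. The equation
  \<open>f(p\<^sub>1/q, \<dots>, p\<^sub>n/q) = h\<^sup>2\<close> survives since it is a polynomial identity once denominators are cleared.
\<close>
lemma sqrt_rationalizable_of_transcendental_variable:
  fixes f :: "'n::{finite,linorder} mpoly"
    and \<psi> :: "'n ratfun \<Rightarrow> 'n option ratfun"
  assumes \<psi>: "algebra_hom \<psi>"
    and trans: "transcendental \<psi> (ratfun_of (mvar None))"
    and square: "\<psi> (ratfun_of f) = h ^ 2"
  shows "sqrt_rationalizable f"
proof -
  note hom = algebra_hom_ring_morph [OF \<psi>]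
  obtain p q where q: "q \<noteq> 0"
    and p: "\<And>i. case_option h (\<lambda>i. \<psi> (ratfun_of (mvar i))) i = ratfun_of (p i) / ratfun_of q"
    using common_denominator [of "case_option h (\<lambda>i. \<psi> (ratfun_of (mvar i)))"] by metis
  have h: "h = ratfun_of (p None) / ratfun_of q" using p [of None] by simp
  have \<psi>_var: "\<psi> (ratfun_of (mvar i)) = ratfun_of (p (Some i)) / ratfun_of q" for i
    using p [of "Some i"] by simp
  have \<psi>_eval: "\<psi> (ratfun_of P) = meval ratconst (\<lambda>i. ratfun_of (p (Some i)) / ratfun_of q) P" for P
    using algebra_hom_ratfun_of [OF \<psi>, of P] by (simp add: ratfun_eval_eq_meval \<psi>_var)
  \<comment> \<open>\<open>G N m\<close> is \<open>q\<^sup>N\<close> times the monomial \<open>m\<close> in the fractions \<open>p\<^sub>i/q\<close>, by \<open>H_G\<close>, and \<open>numer P\<close> is the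
    corresponding combination for a polynomial \<open>P\<close>. Both \<open>ratfun_of\<close> and specialization are used for \<open>H\<close>.\<close>
  define G where "G N m = q ^ (N - monom_deg m) * (\<Prod>i\<in>UNIV. p (Some i) ^ Poly_Mapping.lookup m i)"
    for N m
  have H_G: "H (G N m) = H q ^ N * (\<Prod>i\<in>UNIV. (H (p (Some i)) / H q) ^ Poly_Mapping.lookup m i)"
    if H: "ring_morph H" "H q \<noteq> 0" "monom_deg m \<le> N" for H :: "'n option mpoly \<Rightarrow> 'a::field" and N m
  proof -
    have "H q ^ N = H q ^ (N - monom_deg m) * H q ^ monom_deg m"
      using H(3) by (simp flip: power_add)
    moreover have "(\<Prod>i\<in>UNIV. (H (p (Some i)) / H q) ^ Poly_Mapping.lookup m i) =
        (\<Prod>i\<in>UNIV. H (p (Some i)) ^ Poly_Mapping.lookup m i) / H q ^ monom_deg m"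
      by (simp add: power_divide prod_dividef monom_deg_eq_sum_UNIV power_sum)
    ultimately show ?thesis
      using H(2) by (simp add: G_def ring_morph.mult ring_morph.power ring_morph.prod H(1))
  qed
  define numer where "numer P = (\<Sum>m\<in>Poly_Mapping.keys P.
    mconst (Poly_Mapping.lookup P m) * G (total_degree P) m)" for P
  have H_numer: "H (numer P) = H q ^ total_degree P *
      meval (\<lambda>c. H (mconst c)) (\<lambda>i. H (p (Some i)) / H q) P"
    if H: "ring_morph H" "H q \<noteq> 0" for H :: "'n option mpoly \<Rightarrow> 'a::field" and P
    using H by (simp add: numer_def meval_def ring_morph.sum ring_morph.mult H_G
        monom_deg_le_total_degree sum_distrib_left mult_ac)
  \<comment> \<open>Chosen so that \<open>N (keys P)\<close> is the total degree of \<open>P\<close>.\<close>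
  define N where "N S = Max (insert 0 (monom_deg ` S))" for S :: "('n \<Rightarrow>\<^sub>0 nat) set"
  define bad where "bad S = {c. \<exists>\<mu>. (\<forall>e. (\<Sum>m\<in>S. \<mu> m * poly (coord e (G (N S) m)) c) = 0) \<and>
    (\<exists>m\<in>S. \<mu> m \<noteq> 0)}" for S
  have "finite (bad S)" if S: "finite S" for S
    unfolding bad_def
  proof (rule finite_dependent_specializations [OF S])
    fix l n assume l: "\<And>e. (\<Sum>m\<in>S. l m * coord e (G (N S) m)) = 0" and n: "n \<in> S"
    let ?x = "ratfun_of (mvar None) :: 'n option ratfun"
    let ?X = "\<lambda>m. ratfun_of (Poly_Mapping.single m 1) :: 'n ratfun"
    have G: "ratfun_of (G (N S) m) = ratfun_of q ^ N S * \<psi> (?X m)" if "m \<in> S" for m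
    proof -
      have "monom_deg m \<le> N S" unfolding N_def using that S by (intro Max_ge) auto
      then show ?thesis
        using q by (simp add: H_G [OF ring_morph_ratfun_of] ratfun_of_eq_0_iff \<psi>_eval
            meval_single ring_morph_ratconst ring_morph.one)
    qed
    have "0 = ratfun_of (\<Sum>m\<in>S. of_poly (map_poly mconst (l m)) * G (N S) m)"
      using coord_combination_eq_0D [OF l] by (simp add: ratfun_of_0)
    also have "\<dots> = ratfun_of q ^ N S * (\<Sum>m\<in>S. poly (map_poly ratconst (l m)) ?x * \<psi> (?X m))"
      by (simp add: ratfun_of_sum ratfun_of_mult ratfun_of_of_poly_mconst G sum_distrib_left mult_ac)
    finally have 0: "(\<Sum>m\<in>S. poly (map_poly ratconst (l m)) ?x * \<psi> (?X m)) = 0"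
      using q by (simp add: ratfun_of_eq_0_iff)
    \<comment> \<open>The relation sorted by powers of \<open>x\<^sub>0\<close>, with coefficients in \<open>k[X\<^sub>1, \<dots>, X\<^sub>n]\<close>.\<close>
    define T where "T = (\<Sum>m\<in>S. [:?X m:] * map_poly ratconst (l m))"
    have "poly (map_poly \<psi> T) ?x = (\<Sum>m\<in>S. poly (map_poly ratconst (l m)) ?x * \<psi> (?X m))"
    proof -
      have "map_poly \<psi> (map_poly ratconst P) = map_poly ratconst P" for P
        by (simp add: map_poly_map_poly_morph hom ring_morph_ratconst algebra_hom_ratconst [OF \<psi>])
      then show ?thesis
        unfolding T_def ring_morph.sum [OF ring_morph_map_poly [OF hom]]
          ring_morph.mult [OF ring_morph_map_poly [OF hom]] poly_sum
        by (simp add: map_poly_pCons_morph hom mult.commute)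
    qed
    then have "T = 0" using 0 trans by (simp add: transcendental_def)
    have "coeff (l n) k = 0" for k
    proof (rule linear_independent_monomials [OF S _ n])
      have "coeff T k = (\<Sum>m\<in>S. ratconst (coeff (l m) k) * ?X m)"
        by (simp add: T_def coeff_sum coeff_map_poly ring_morph.zero ring_morph_ratconst mult.commute)
      then show "(\<Sum>m\<in>S. ratconst (coeff (l m) k) * ?X m) = 0" using \<open>T = 0\<close> by simp
    qed
    then show "l n = 0" by (intro poly_eqI) simp
  qed
  then have "countable (\<Union>S\<in>{S. finite S}. bad S)"
    by (intro countable_UN countable_finite_sets_of_exponents) (simp add: countable_finite)
  moreover have "countable {c. specialize c q = 0}"
  proof -
    have "as_poly q \<noteq> 0" using q of_poly_as_poly [of q] by auto
    then have "finite {u. poly (as_poly q) u = 0}" by (rule poly_roots_finite)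
    moreover have "inj (mconst :: complex \<Rightarrow> 'n mpoly)"
      unfolding mconst_def by (rule injI) (metis lookup_single_eq)
    ultimately have "finite (mconst -` {u. poly (as_poly q) u = 0})" by (rule finite_vimageI)
    then show ?thesis by (simp add: specialize_def vimage_def countable_finite)
  qed
  ultimately have "countable ((\<Union>S\<in>{S. finite S}. bad S) \<union> {c. specialize c q = 0})"
    by (rule countable_Un)
  then have "(\<Union>S\<in>{S. finite S}. bad S) \<union> {c. specialize c q = 0} \<noteq> UNIV"
    using uncountable_UNIV_complex by metis
  then obtain c where good: "\<And>S. finite S \<Longrightarrow> c \<notin> bad S" and qc: "specialize c q \<noteq> 0"
    by blast
  define H :: "'n option mpoly \<Rightarrow> 'n ratfun" where "H g = ratfun_of (specialize c g)" for g
  have H: "ring_morph H" unfolding H_def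
    by (rule ring_morph_comp [OF ring_morph_ratfun_of ring_morph_specialize])
  have Hq: "H q \<noteq> 0" using qc by (simp add: H_def ratfun_of_eq_0_iff)
  have H_const: "H (mconst a) = ratconst a" for a by (simp add: H_def specialize_mconst ratconst_def)
  define e where "e = meval ratconst (\<lambda>i. H (p (Some i)) / H q)"
  have H_numer_e: "H (numer P) = H q ^ total_degree P * e P" for P
    by (simp add: H_numer [OF H Hq] H_const e_def)
  have "P = 0" if "e P = 0" for P
  proof -
    let ?S = "Poly_Mapping.keys P"
    have "specialize c (numer P) = 0"
      using that H_numer_e [of P] by (simp add: H_def ratfun_of_eq_0_iff)
    moreover have "specialize c (numer P) = (\<Sum>m\<in>?S.
        mconst (Poly_Mapping.lookup P m) * specialize c (G (N ?S) m))"
      by (simp add: numer_def ring_morph.sum ring_morph.mult ring_morph_specialize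
          specialize_mconst N_def total_degree_def)
    ultimately have "\<forall>e. (\<Sum>m\<in>?S. Poly_Mapping.lookup P m * poly (coord e (G (N ?S) m)) c) = 0"
      by (simp add: poly_coord flip: lookup_mconst_mult lookup_sum)
    moreover have "c \<notin> bad ?S" by (rule good) simp
    ultimately have "\<forall>m\<in>?S. Poly_Mapping.lookup P m = 0" unfolding bad_def by blast
    then have "?S = {}" by (metis all_not_in_conv in_keys_iff)
    then show ?thesis by simp
  qed
  moreover have "ring_morph e" unfolding e_def by (rule ring_morph_meval [OF ring_morph_ratconst])
  moreover have "e (mconst a) = ratconst a" for a by (simp add: e_def meval_mconst ring_morph_ratconst)
  ultimately obtain \<Phi> :: "'n ratfun \<Rightarrow> 'n ratfun"
    where \<Phi>: "algebra_hom \<Phi>" "\<And>P. \<Phi> (ratfun_of P) = e P"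
    using morph_extends_to_ratfun by blast
  have "ratfun_of (numer f) * ratfun_of q ^ 2 =
      ratfun_of q ^ total_degree f * ratfun_of (p None) ^ 2"
  proof -
    have "ratfun_of (numer f) = ratfun_of q ^ total_degree f * \<psi> (ratfun_of f)"
      using q by (simp add: H_numer [OF ring_morph_ratfun_of] ratfun_of_eq_0_iff \<psi>_eval
          flip: ratconst_def)
    then show ?thesis using q by (simp add: square h power_divide ratfun_of_eq_0_iff)
  qed
  then have "numer f * q ^ 2 = q ^ total_degree f * p None ^ 2"
    by (simp add: ratfun_of_inject flip: ratfun_of_power ratfun_of_mult)
  then have "H (numer f) * H q ^ 2 = H q ^ total_degree f * H (p None) ^ 2"
    by (metis ring_morph.mult [OF H] ring_morph.power [OF H])
  then have "\<Phi> (ratfun_of f) = (H (p None) / H q) ^ 2"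
    using Hq by (simp add: \<Phi>(2) H_numer_e power_divide field_simps)
  then show ?thesis using \<Phi>(1) unfolding sqrt_rationalizable_def by blast
qed

text \<open>
  \<open>\<Phi>(x\<^sub>0)\<close> is transcendental over \<open>\<Phi>(Q)\<close>, hence so is at least one of the variables.
\<close>
lemma sqrt_rationalizable_of_add_var:
  fixes f :: "'n::{finite,linorder} mpoly"
  assumes "sqrt_rationalizable (add_var f)"
  shows "sqrt_rationalizable f"
proof -
  obtain \<Phi> :: "'n option ratfun \<Rightarrow> 'n option ratfun" and h
    where \<Phi>: "algebra_hom \<Phi>" "\<Phi> (ratfun_of (add_var f)) = h ^ 2"
    using assms by (auto simp: sqrt_rationalizable_def)
  obtain \<iota> :: "'n ratfun \<Rightarrow> 'n option ratfun"
    where \<iota>: "algebra_hom \<iota>" "\<And>p. \<iota> (ratfun_of p) = ratfun_of (add_var p)"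
    using ratfun_add_var by blast
  define \<psi> where "\<psi> z = \<Phi> (\<iota> z)" for z
  have \<psi>: "algebra_hom \<psi>" unfolding \<psi>_def by (rule algebra_hom_comp [OF \<Phi>(1) \<iota>(1)])
  have "transcendental \<psi> (\<Phi> (ratfun_of (mvar None)))"
    unfolding \<psi>_def
    by (rule transcendental_image [OF _ _ transcendental_new_variable [OF \<iota>]])
      (simp_all add: algebra_hom_ring_morph \<Phi>(1) \<iota>(1))
  then obtain j where j: "transcendental \<psi> (ratfun_of (mvar j))"
    using algebraic_of_algebraic_variables [OF algebra_hom_ring_morph [OF \<psi>]]
      algebra_hom_ratconst [OF \<psi>] by (metis rangeI)
  \<comment> \<open>Swap the variables \<open>x\<^sub>j\<close> and \<open>x\<^sub>0\<close>, so that \<open>x\<^sub>0\<close> becomes the transcendental one.\<close>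
  define t where "t = (\<lambda>i. if i = None then j else if i = j then None else i)"
  have tt: "t (t i) = i" for i by (auto simp: t_def)
  define \<pi> :: "'n option mpoly \<Rightarrow> 'n option mpoly" where "\<pi> = meval mconst (\<lambda>i. mvar (t i))"
  have \<pi>: "ring_morph \<pi>" unfolding \<pi>_def by (rule ring_morph_meval [OF ring_morph_mconst])
  have \<pi>_simps: "\<pi> (mconst c) = mconst c" "\<pi> (mvar i) = mvar (t i)" for c i
    by (simp_all add: \<pi>_def meval_mconst meval_mvar ring_morph_mconst)
  have \<pi>\<pi>: "\<pi> (\<pi> p) = p" for p
    by (rule mpoly_morph_eqI [where h = "\<lambda>p. p", OF ring_morph_comp [OF \<pi> \<pi>]])
      (simp_all add: \<pi>_simps tt ring_morph_def)
  obtain \<Pi> :: "'n option ratfun \<Rightarrow> 'n option ratfun"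
    where \<Pi>: "algebra_hom \<Pi>" "\<And>p. \<Pi> (ratfun_of p) = ratfun_of (\<pi> p)"
  proof (rule morph_extends_to_ratfun [of "\<lambda>p. ratfun_of (\<pi> p)"])
    show "ring_morph (\<lambda>p. ratfun_of (\<pi> p))" by (rule ring_morph_comp [OF ring_morph_ratfun_of \<pi>])
    show "ratfun_of (\<pi> (mconst c)) = ratconst c" for c by (simp add: \<pi>_simps ratconst_def)
    show "p = 0" if "ratfun_of (\<pi> p) = 0" for p
      using that \<pi>\<pi> [of p] by (simp add: ratfun_of_eq_0_iff ring_morph.zero [OF \<pi>])
  qed blast
  show ?thesis
  proof (rule sqrt_rationalizable_of_transcendental_variable)
    show "algebra_hom (\<lambda>z. \<Pi> (\<psi> z))" by (rule algebra_hom_comp [OF \<Pi>(1) \<psi>])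
    have "\<Pi> (ratfun_of (mvar j)) = ratfun_of (mvar None)"
      by (auto simp: \<Pi>(2) \<pi>_simps t_def)
    then show "transcendental (\<lambda>z. \<Pi> (\<psi> z)) (ratfun_of (mvar None))"
      using transcendental_image [OF algebra_hom_ring_morph [OF \<Pi>(1)] algebra_hom_ring_morph [OF \<psi>] j]
      by simp
    show "\<Pi> (\<psi> (ratfun_of f)) = \<Pi> h ^ 2"
      by (simp add: \<psi>_def \<iota>(2) \<Phi>(2) ring_morph.power [OF algebra_hom_ring_morph [OF \<Pi>(1)]])
  qed
qed

section \<open>Homogenization\<close>

text \<open>
  \<open>\<theta>\<close> multiplies each \<open>x\<^sub>i\<close> with \<open>i \<ge> 1\<close> by \<open>x\<^sub>0\<close>, and \<open>\<theta>'\<close> divides it by \<open>x\<^sub>0\<close>. Each must be known to be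
  injective on polynomials before it extends to rational functions. The substitution \<open>a\<close> defining
  \<open>\<theta>\<close> has polynomial values, so the plain ring homomorphism \<open>b\<close> defining \<open>\<theta>'\<close> can be applied after
  it and is a left inverse; once \<open>\<theta>\<close> exists, it is in turn a left inverse of \<open>b\<close>.
\<close>
lemma dehomogenizing_automorphism:
  obtains \<theta> \<theta>' :: "'n::{finite,linorder} option ratfun \<Rightarrow> 'n option ratfun"
  where "algebra_hom \<theta>" "algebra_hom \<theta>'" "\<And>z. \<theta> (\<theta>' z) = z"
    "\<theta> (ratfun_of (mvar None)) = ratfun_of (mvar None)"
    "\<And>i. \<theta>' (ratfun_of (mvar (Some i))) = ratfun_of (mvar (Some i)) / ratfun_of (mvar None)"
proof -
  let ?x = "ratfun_of (mvar None) :: 'n option ratfun"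
  have x: "?x \<noteq> 0" by (simp add: ratfun_of_eq_0_iff mvar_nonzero)
  define a :: "'n option mpoly \<Rightarrow> 'n option mpoly"
    where "a = meval mconst (case_option (mvar None) (\<lambda>i. mvar (Some i) * mvar None))"
  define b :: "'n option mpoly \<Rightarrow> 'n option ratfun"
    where "b = meval ratconst (case_option ?x (\<lambda>i. ratfun_of (mvar (Some i)) / ?x))"
  have a: "ring_morph a" unfolding a_def by (rule ring_morph_meval [OF ring_morph_mconst])
  have b: "ring_morph b" unfolding b_def by (rule ring_morph_meval [OF ring_morph_ratconst])
  have a_simps: "a (mconst c) = mconst c" "a (mvar None) = mvar None"
    "a (mvar (Some i)) = mvar (Some i) * mvar None" for c i
    by (simp_all add: a_def meval_mconst meval_mvar ring_morph_mconst)
  have b_simps: "b (mconst c) = ratconst c" "b (mvar None) = ?x"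
    "b (mvar (Some i)) = ratfun_of (mvar (Some i)) / ?x" for c i
    by (simp_all add: b_def meval_mconst meval_mvar ring_morph_ratconst)
  have ba: "b (a p) = ratfun_of p" for p
  proof (rule mpoly_morph_eqI [OF ring_morph_comp [OF b a] ring_morph_ratfun_of])
    show "b (a (mvar i)) = ratfun_of (mvar i)" for i
      using x by (cases i) (simp_all add: a_simps b_simps ring_morph.mult [OF b])
  qed (simp add: a_simps b_simps ratconst_def)
  obtain \<theta> :: "'n option ratfun \<Rightarrow> 'n option ratfun"
    where \<theta>: "algebra_hom \<theta>" "\<And>p. \<theta> (ratfun_of p) = ratfun_of (a p)"
  proof (rule morph_extends_to_ratfun [of "\<lambda>p. ratfun_of (a p)"])
    show "ring_morph (\<lambda>p. ratfun_of (a p))" by (rule ring_morph_comp [OF ring_morph_ratfun_of a])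
    show "ratfun_of (a (mconst c)) = ratconst c" for c by (simp add: a_simps ratconst_def)
    show "p = 0" if "ratfun_of (a p) = 0" for p
      using that ba [of p] by (simp add: ratfun_of_eq_0_iff ring_morph.zero [OF b])
  qed blast
  note \<theta>_hom = algebra_hom_ring_morph [OF \<theta>(1)]
  have \<theta>b: "\<theta> (b p) = ratfun_of p" for p
  proof (rule mpoly_morph_eqI [OF ring_morph_comp [OF \<theta>_hom b] ring_morph_ratfun_of])
    show "\<theta> (b (mvar i)) = ratfun_of (mvar i)" for i
      using x by (cases i)
        (simp_all add: a_simps b_simps \<theta>(2) field_morph_divide [OF \<theta>_hom] ratfun_of_mult)
    show "\<theta> (b (mconst c)) = ratfun_of (mconst c)" for c
      using algebra_hom_ratconst [OF \<theta>(1)] by (simp add: b_simps ratconst_def)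
  qed
  obtain \<theta>' :: "'n option ratfun \<Rightarrow> 'n option ratfun"
    where \<theta>': "algebra_hom \<theta>'" "\<And>p. \<theta>' (ratfun_of p) = b p"
  proof (rule morph_extends_to_ratfun [OF b])
    show "p = 0" if "b p = 0" for p
      using that \<theta>b [of p] by (simp add: ratfun_of_eq_0_iff ring_morph.zero [OF \<theta>_hom])
  qed (auto simp: b_simps)
  have "\<theta> (\<theta>' z) = z" for z
    by (rule ratfun_cases [of z])
      (simp add: field_morph_divide algebra_hom_ring_morph \<theta>(1) \<theta>'(1) \<theta>'(2) \<theta>b)
  then show ?thesis
    using that [OF \<theta>(1) \<theta>'(1)] by (simp add: \<theta>(2) \<theta>'(2) a_simps b_simps)
qed

text \<open>
  The theorem uses \<open>k = 0\<close> for even degree \<open>d\<close> and \<open>k = 1\<close> for odd \<open>d\<close>. The automorphism \<open>\<theta>\<close> carries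
  \<open>x\<^sub>0\<^sup>k F\<close> to \<open>x\<^sub>0\<^bsup>k+d\<^esup> f(x\<^sub>1, \<dots>, x\<^sub>n)\<close>, where the power of \<open>x\<^sub>0\<close> is a square because \<open>k + d\<close> is even.
\<close>
lemma sqrt_rationalizable_homogenize_iff:
  fixes f :: "'n::{finite,linorder} mpoly"
  assumes "even (k + total_degree f)"
  shows "sqrt_rationalizable (mvar None ^ k * homogenize f) \<longleftrightarrow> sqrt_rationalizable f"
proof -
  obtain r where r: "k + total_degree f = 2 * r" using assms by (elim evenE)
  let ?x = "ratfun_of (mvar None) :: 'n option ratfun"
  have x: "?x \<noteq> 0" by (simp add: ratfun_of_eq_0_iff mvar_nonzero)
  obtain \<theta> \<theta>' :: "'n option ratfun \<Rightarrow> 'n option ratfun"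
    where \<theta>: "algebra_hom \<theta>" and \<theta>': "algebra_hom \<theta>'" and inv: "\<And>z. \<theta> (\<theta>' z) = z"
      and \<theta>_x: "\<theta> ?x = ?x"
      and \<theta>'_var: "\<And>i. \<theta>' (ratfun_of (mvar (Some i))) = ratfun_of (mvar (Some i)) / ?x"
    using dehomogenizing_automorphism [where 'n = 'n] by metis
  have "\<theta>' (ratfun_of (add_var f)) =
      ratfun_eval (\<lambda>i. ratfun_of (mvar (Some i)) / ?x) f"
  proof -
    have "ring_morph (\<lambda>p. \<theta>' (ratfun_of (add_var p)))"
      by (rule ring_morph_comp [OF algebra_hom_ring_morph [OF \<theta>']
            ring_morph_comp [OF ring_morph_ratfun_of ring_morph_add_var]])
    from ring_morph_eq_meval [OF this, of f] show ?thesis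
      using algebra_hom_ratconst [OF \<theta>'] by (simp add: ratfun_eval_eq_meval \<theta>'_var flip: ratconst_def)
  qed
  then have F: "ratfun_of (mvar None ^ k * homogenize f) = (?x ^ r) ^ 2 * \<theta>' (ratfun_of (add_var f))"
    by (simp add: ratfun_of_mult ratfun_of_power ratfun_of_homogenize r
        flip: mult.assoc power_add power_mult) (simp add: mult.commute)
  have "\<theta> (ratfun_of (mvar None ^ k * homogenize f)) = (?x ^ r) ^ 2 * ratfun_of (add_var f)"
    unfolding F using algebra_hom_ring_morph [OF \<theta>]
    by (simp add: ring_morph.mult ring_morph.power \<theta>_x inv)
  moreover have "\<theta>' (ratfun_of (add_var f)) =
      (1 / ?x ^ r) ^ 2 * ratfun_of (mvar None ^ k * homogenize f)"
    using x by (simp add: F power_divide)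
  ultimately have "sqrt_rationalizable (mvar None ^ k * homogenize f) \<longleftrightarrow>
      sqrt_rationalizable (add_var f)"
    using sqrt_rationalizable_transfer \<theta> \<theta>' by metis
  also have "\<dots> \<longleftrightarrow> sqrt_rationalizable f"
    using sqrt_rationalizable_add_var sqrt_rationalizable_of_add_var by blast
  finally show ?thesis .
qed

theorem proposition41:
  fixes f :: "'n::{finite,linorder} mpoly" and d :: nat
  assumes "\<not> (\<exists>c. f = mconst c)"
    and "squarefree f"
    and "total_degree f = d"
  shows "(even d \<longrightarrow> (sqrt_rationalizable f \<longleftrightarrow> sqrt_rationalizable (homogenize f))) \<and>
    (odd d \<longrightarrow> (sqrt_rationalizable f \<longleftrightarrow> sqrt_rationalizable (mvar None * homogenize f)))"
  using sqrt_rationalizable_homogenize_iff [of 0 f] sqrt_rationalizable_homogenize_iff [of 1 f]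
    assms(3) by auto

end
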